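(* Let $\mathbb{M}$ be a weight sequence. If $\gamma(\mathbb{M})>1$, then the function $$G(z)=\exp\bigl(-P_{\omega_{\mathbb{M}}}(i/z)-iQ_{\omega_{\mathbb{M}}}(i/z)\bigr)$$ is an optimal $\{\mathbb{M}\}$-flat function in the halfplane $S_1=\{z\in\mathbb{C}:\Re z>0\}$, where $Q_{\omega_{\mathbb{M}}}$ is the harmonic conjugate of $P_{\omega_{\mathbb{M}}}$ in the upper half plane, normalized so that $Q_{\omega_{\mathbb{M}}}(iy)=0$ for all $y>0$.
   Context: A weight sequence is a sequence $\mathbb{M}=(M_p)_{p\in\mathbb{N}_0}$ of positive real numbers with $M_0=1$, logarithmically convex ($M_p^2\le M_{p-1}M_{p+1}$, $p\ge1$), and such that $m_p:=M_{p+1}/M_p\to\infty$. Index: $(c_p)_p$ is almost increasing if there is $a>0$ with $c_p\le a\,c_q$ for all $q\ge p$. $\gamma(\mathbb{M}):=\sup\{\gamma>0:(m_p/(p+1)^\gamma)_{p\in\mathbb{N}_0}\text{ is almost increasing}\}\in[0,\infty]$ ($\sup\emptyset=0$). $\omega_{\mathbb{M}}(t):=\sup_{p\in\mathbb{N}_0}\ln(t^p/M_p)$ for $t>0$, $\omega_{\mathbb{M}}(0)=0$; $h_{\mathbb{M}}(t):=\inf_{p\in\mathbb{N}_0}M_pt^p$ for $t>0$. If $\gamma(\mathbb{M})>1$ then $\int_1^\infty\omega_{\mathbb{M}}(t)t^{-2}dt<\infty$ and the harmonic extension is $P_{\omega_{\mathbb{M}}}(x+iy)=\frac{|y|}{\pi}\int_{-\infty}^\infty\frac{\omega_{\mathbb{M}}(|t|)}{(t-x)^2+y^2}dt$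 for $x\in\mathbb{R}$, $y\ne0$. A holomorphic function $G\colon S\to\mathbb{C}$ on an unbounded sector $S$ bisected by the positive real axis is an optimal $\{\mathbb{M}\}$-flat function in $S$ if there are $K_1,K_2,K_3,K_4>0$ with $K_1h_{\mathbb{M}}(K_2x)\le G(x)$ for all $x>0$ (in particular $G(x)>0$) and $|G(z)|\le K_3h_{\mathbb{M}}(K_4|z|)$ for all $z\in S$. *)

theory Defs
  imports "HOL-Analysis.Analysis"
begin

definition quotient_seq :: "(nat \<Rightarrow> real) \<Rightarrow> nat \<Rightarrow> real" where
  "quotient_seq M p = M (p + 1) / M p"

definition weight_sequence :: "(nat \<Rightarrow> real) \<Rightarrow> bool" where
  "weight_sequence M \<longleftrightarrow>
     (\<forall>p. M p > 0) \<and> M 0 = 1 \<and>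
     (\<forall>p\<ge>1. (M p)\<^sup>2 \<le> M (p - 1) * M (p + 1)) \<and>
     filterlim (quotient_seq M) at_top sequentially"

definition almost_increasing :: "(nat \<Rightarrow> real) \<Rightarrow> bool" where
  "almost_increasing c \<longleftrightarrow> (\<exists>a>0. \<forall>p q. p \<le> q \<longrightarrow> c p \<le> a * c q)"

(* The value lies in [0,\<infinity>]; in ennreal the supremum of the empty set is 0. *)
definition gamma_index :: "(nat \<Rightarrow> real) \<Rightarrow> ennreal" where
  "gamma_index M =
     Sup {ennreal g | g. g > 0 \<and> almost_increasing (\<lambda>p. quotient_seq M p / real (p + 1) powr g)}"

(* The real supremum below is meaningful for weight sequences: there
   t^p / M p tends to 0, so the logarithms are bounded above. *)
definition omega :: "(nat \<Rightarrow> real) \<Rightarrow> real \<Rightarrow> real" where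
  "omega M t = (if t > 0 then (SUP p. ln (t ^ p / M p)) else 0)"

(* Only used for t > 0, where the values M p * t^p are bounded below by 0. *)
definition h_fun :: "(nat \<Rightarrow> real) \<Rightarrow> real \<Rightarrow> real" where
  "h_fun M t = (INF p. M p * t ^ p)"

(* Only meaningful at points off the real axis. *)
definition harmonic_extension :: "(real \<Rightarrow> real) \<Rightarrow> complex \<Rightarrow> real" where
  "harmonic_extension w z =
     \<bar>Im z\<bar> / pi * (LINT t|lborel. w \<bar>t\<bar> / ((t - Re z)\<^sup>2 + (Im z)\<^sup>2))"

definition harmonic_conjugate_on :: "complex set \<Rightarrow> (complex \<Rightarrow> real) \<Rightarrow> (complex \<Rightarrow> real) \<Rightarrow> bool" where
  "harmonic_conjugate_on U u v \<longleftrightarrow>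
     (\<lambda>z. complex_of_real (u z) + \<i> * complex_of_real (v z)) holomorphic_on U"

(* Q is the harmonic conjugate of P in the upper half plane, normalized to vanish
   on the positive imaginary axis; this determines Q on the upper half plane only. *)
definition normalized_conjugate :: "(complex \<Rightarrow> real) \<Rightarrow> (complex \<Rightarrow> real) \<Rightarrow> bool" where
  "normalized_conjugate P Q \<longleftrightarrow>
     harmonic_conjugate_on {z. Im z > 0} P Q \<and> (\<forall>y::real. y > 0 \<longrightarrow> Q (\<i> * complex_of_real y) = 0)"

(* Unbounded sectors (vertex 0, opening \<alpha> * pi) bisected by the positive real axis, as
   subsets of the plane; sectors of opening larger than 2 * pi, which would live on the
   Riemann surface of the logarithm, are not covered. *)
definition unbounded_sector :: "complex set \<Rightarrow> bool" where
  "unbounded_sector S \<longleftrightarrow>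
     (\<exists>\<alpha>::real. 0 < \<alpha> \<and> \<alpha> \<le> 2 \<and> S = {z. z \<noteq> 0 \<and> \<bar>Arg z\<bar> < \<alpha> * pi / 2})"

(* The inequality K1 * h (K2 * x) \<le> G x for complex G x includes that G x is real. *)
definition optimal_flat :: "(nat \<Rightarrow> real) \<Rightarrow> complex set \<Rightarrow> (complex \<Rightarrow> complex) \<Rightarrow> bool" where
  "optimal_flat M S G \<longleftrightarrow>
     unbounded_sector S \<and> G holomorphic_on S \<and>
     (\<exists>K1 K2 K3 K4 :: real. K1 > 0 \<and> K2 > 0 \<and> K3 > 0 \<and> K4 > 0 \<and>
       (\<forall>x::real. x > 0 \<longrightarrow>
          G (complex_of_real x) \<in> \<real> \<and> K1 * h_fun M (K2 * x) \<le> Re (G (complex_of_real x))) \<and>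
       (\<forall>z\<in>S. norm (G z) \<le> K3 * h_fun M (K4 * norm z)))"

end

theory Submission
  imports Defs "HOL-Probability.Sinc_Integral"
begin

text \<open>
  Write \<open>P\<close> for the harmonic extension of \<open>\<omega> = omega M\<close>. As \<open>h_fun M t = exp (- \<omega> (1 / t))\<close> and
  \<open>\<bar>G z\<bar> = exp (- P (\<i> / z))\<close>, flatness amounts to two comparisons of \<open>P\<close> with \<open>\<omega>\<close>.

  From below, \<open>\<omega>\<close> is a supremum of affine functions of \<open>ln t\<close> with slope \<open>p \<ge> 0\<close>, and the Poisson
  integral of \<open>ln \<bar>t\<bar>\<close> at \<open>z\<close> is at least \<open>ln \<bar>z\<bar> - C\<close>; hence \<open>P z \<ge> \<omega> (exp (- C) \<bar>z\<bar>)\<close>.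

  From above, let \<open>p\<close> be the index at which the supremum defining \<open>\<omega> y\<close> is attained. The condition
  \<open>gamma_index M > 1\<close> bounds the maximizing index at \<open>y s\<close> by a multiple of \<open>(p + 1) s powr (1 / g)\<close>
  with \<open>g > 1\<close>, so \<open>\<omega> (y s) \<le> \<omega> y + (p + 1) B s powr d\<close> for some \<open>d < 1\<close>. Integrating gives
  \<open>P (\<i> y) \<le> \<omega> y + (p + 1) D\<close>, and \<open>\<omega> y + p D \<le> \<omega> (exp D y)\<close> by the choice of \<open>p\<close>.
\<close>

section \<open>Integrability on the real line and the Poisson kernel\<close>

lemma integrable_of_nonneg_integrable_on:
  fixes f :: "real \<Rightarrow> real"
  assumes "f integrable_on S" "\<And>x. x \<in> S \<Longrightarrow> 0 \<le> f x"
    and "f \<in> borel_measurable borel" "S \<in> sets borel"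
  shows "integrable lborel (\<lambda>x. indicator S x *\<^sub>R f x)"
proof -
  have "set_integrable lebesgue S f"
    using nonnegative_absolutely_integrable_1[OF assms(1,2)] .
  then have "integrable (completion lborel) (\<lambda>x. indicator S x *\<^sub>R f x)"
    by (simp add: set_integrable_def)
  moreover have "(\<lambda>x. indicator S x *\<^sub>R f x) \<in> borel_measurable lborel"
    using assms(3,4) by simp
  ultimately show ?thesis
    using integrable_completion by blast
qed

lemma integrable_even:
  fixes f :: "real \<Rightarrow> real"
  assumes "integrable lborel (\<lambda>x. indicator {0..} x *\<^sub>R f x)" "\<And>x. f (-x) = f x"
  shows "integrable lborel f"
  using has_bochner_integral_even_function[OF has_bochner_integral_integrable[OF assms(1)] assms(2)]
  by (simp add: has_bochner_integral_iff)

text \<open>Supplies the majorant for the logarithmic singularity at 0 in the lower bound on Poisson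
  integrals.\<close>

lemma integrable_inverse_sqrt_abs:
  "integrable lborel (\<lambda>s::real. indicator {-1..1} s * \<bar>s\<bar> powr (-1/2))"
proof (rule integrable_even)
  have "integrable lborel (\<lambda>s::real. indicator {0..1} s *\<^sub>R s powr (-1/2))"
    using has_integral_powr_from_0[of "-1/2" 1]
    by (intro integrable_of_nonneg_integrable_on) (auto simp: integrable_on_def)
  then show "integrable lborel
      (\<lambda>s::real. indicator {0..} s *\<^sub>R (indicator {-1..1} s * \<bar>s\<bar> powr (-1/2)))"
    by (rule back_subst[of "integrable lborel"]) (auto simp: indicator_def fun_eq_iff)
qed (auto simp: indicator_def)

lemma integrable_Cauchy_density: "integrable lborel (\<lambda>t::real. 1 / (1 + t\<^sup>2))"
  using integrable_inverse_1_plus_square by (simp add: set_integrable_def divide_inverse)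

lemma integral_Cauchy_density: "(LINT t|lborel. 1 / (1 + t\<^sup>2)) = pi"
  using LBINT_inverse_1_plus_square
  by (simp add: interval_lebesgue_integral_def set_lebesgue_integral_def divide_inverse)

text \<open>By evenness it suffices to treat \<open>t \<ge> 0\<close>: below 1 the Cauchy density
  dominates, from 1 on \<open>t powr (d - 2)\<close> does, which is integrable at infinity because
  \<open>d < 1\<close>.\<close>

lemma integrable_powr_Cauchy_density:
  fixes d :: real
  assumes "0 < d" "d < 1"
  shows "integrable lborel (\<lambda>t::real. \<bar>t\<bar> powr d / (1 + t\<^sup>2))"
proof (rule integrable_even)
  have "integrable lborel (\<lambda>s::real. indicator {1..} s *\<^sub>R s powr (d - 2))"
    using has_integral_powr_to_inf[of "d - 2" 1] assms
    by (intro integrable_of_nonneg_integrable_on) (auto simp: integrable_on_def)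
  then have "integrable lborel (\<lambda>t::real. 1 / (1 + t\<^sup>2) + indicator {1..} t *\<^sub>R t powr (d - 2))"
    by (intro Bochner_Integration.integrable_add integrable_Cauchy_density)
  then show "integrable lborel (\<lambda>t::real. indicator {0..} t *\<^sub>R (\<bar>t\<bar> powr d / (1 + t\<^sup>2)))"
  proof (rule Bochner_Integration.integrable_bound)
    have "norm (indicator {0..} t *\<^sub>R (\<bar>t\<bar> powr d / (1 + t\<^sup>2)))
        \<le> norm (1 / (1 + t\<^sup>2) + indicator {1..} t *\<^sub>R t powr (d - 2))" for t :: real
    proof -
      consider "t < 0" | "0 \<le> t" "t < 1" | "1 \<le> t" by linarith
      then show ?thesis
      proof cases
        case 2
        then have "t powr d \<le> 1"
          using assms by (intro powr_le1) auto
        then show ?thesis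
          using 2 by (auto simp: indicator_def intro!: divide_right_mono)
      next
        case 3
        have "t powr d / (1 + t\<^sup>2) \<le> t powr d / t\<^sup>2"
          using 3 by (intro divide_left_mono mult_pos_pos) (auto intro: add_pos_nonneg)
        also have "\<dots> = t powr (d - 2)"
          using 3 by (simp add: powr_diff)
        finally have "t powr d / (1 + t\<^sup>2) \<le> 1 / (1 + t\<^sup>2) + t powr (d - 2)"
          by (simp add: add_increasing)
        then show ?thesis
          using 3 by (simp add: indicator_def)
      qed (simp add: indicator_def)
    qed
    then show "AE t in lborel. norm (indicator {0..} t *\<^sub>R (\<bar>t\<bar> powr d / (1 + t\<^sup>2)))
        \<le> norm (1 / (1 + t\<^sup>2) + indicator {1..} t *\<^sub>R t powr (d - 2))"
      by simp
  qed simp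
qed simp

text \<open>The substitution \<open>t = x + y * s\<close> turns the kernel into the Cauchy density,
  whose integral is \<open>pi\<close>.\<close>

lemma has_bochner_integral_Poisson_kernel:
  fixes x y :: real
  assumes "y > 0"
  shows "has_bochner_integral lborel (\<lambda>t. y / ((t - x)\<^sup>2 + y\<^sup>2)) pi"
proof -
  have "(\<lambda>t. y / ((x + y * t - x)\<^sup>2 + y\<^sup>2)) = (\<lambda>t. (1 / (1 + t\<^sup>2)) / y)"
  proof
    fix t
    have "(x + y * t - x)\<^sup>2 + y\<^sup>2 = y * (y * (1 + t\<^sup>2))"
      by (simp add: power2_eq_square algebra_simps)
    then show "y / ((x + y * t - x)\<^sup>2 + y\<^sup>2) = (1 / (1 + t\<^sup>2)) / y"
      using assms by simp
  qed
  moreover have "has_bochner_integral lborel (\<lambda>t. (1 / (1 + t\<^sup>2)) / y) (pi / y)"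
    using has_bochner_integral_divide_zero[of y,
        OF has_bochner_integral_integrable[OF integrable_Cauchy_density]]
    unfolding integral_Cauchy_density by simp
  ultimately show ?thesis
    using assms
    by (subst lborel_has_bochner_integral_real_affine_iff[where c = y and t = x])
       (auto simp: divide_inverse mult.commute)
qed

text \<open>Reduces convergence of the Poisson integral at any point off the real axis to
  integrability against \<open>1 / (1 + t^2)\<close>.\<close>

lemma Poisson_kernel_comparison:
  fixes t x y :: real
  assumes "y \<noteq> 0"
  shows "1 + t\<^sup>2 \<le> (2 + (1 + 2 * x\<^sup>2) / y\<^sup>2) * ((t - x)\<^sup>2 + y\<^sup>2)"
proof -
  \<comment> \<open>The right side minus the left side is \<open>(t - 2 * x)^2\<close>.\<close>
  have "t\<^sup>2 \<le> 2 * (t - x)\<^sup>2 + 2 * x\<^sup>2"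
    using zero_le_power2[of "t - 2 * x"] by (simp add: power2_eq_square algebra_simps)
  moreover have "(1 + 2 * x\<^sup>2) / y\<^sup>2 * y\<^sup>2 = 1 + 2 * x\<^sup>2"
    using assms by simp
  moreover have "0 \<le> (1 + 2 * x\<^sup>2) / y\<^sup>2 * (t - x)\<^sup>2" "0 \<le> y\<^sup>2"
    by auto
  ultimately show ?thesis
    by (simp only: distrib_left distrib_right)
qed

text \<open>Multiplying the positive factor \<open>1 + t^2\<close> back in lets later lemmas draw
  measurability of \<open>u\<close> from the single integrability assumption.\<close>

lemma borel_measurable_of_Cauchy_integrable:
  fixes u :: "real \<Rightarrow> real"
  assumes "integrable lborel (\<lambda>t. u t / (1 + t\<^sup>2))"
  shows "u \<in> borel_measurable borel"
proof -
  have "(\<lambda>t. u t / (1 + t\<^sup>2) * (1 + t\<^sup>2)) \<in> borel_measurable lborel"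
    using borel_measurable_integrable[OF assms] by measurable
  moreover have "u t / (1 + t\<^sup>2) * (1 + t\<^sup>2) = u t" for t
    by (smt (verit) nonzero_eq_divide_eq zero_le_power2)
  ultimately show ?thesis
    by simp
qed

lemma integrable_Poisson:
  fixes u :: "real \<Rightarrow> real"
  assumes u: "integrable lborel (\<lambda>t. u t / (1 + t\<^sup>2))" and y: "y \<noteq> 0"
  shows "integrable lborel (\<lambda>t. u t / ((t - x)\<^sup>2 + y\<^sup>2))"
proof -
  define C where "C = 2 + (1 + 2 * x\<^sup>2) / y\<^sup>2"
  have [measurable]: "u \<in> borel_measurable borel"
    by (rule borel_measurable_of_Cauchy_integrable[OF u])
  have "integrable lborel (\<lambda>t. C * (u t / (1 + t\<^sup>2)))"
    using u by (rule integrable_mult_right)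
  then show ?thesis
  proof (rule Bochner_Integration.integrable_bound)
    have "norm (u t / ((t - x)\<^sup>2 + y\<^sup>2)) \<le> norm (C * (u t / (1 + t\<^sup>2)))" for t
    proof -
      have pos: "0 < (t - x)\<^sup>2 + y\<^sup>2" "0 < 1 + t\<^sup>2" "0 \<le> C"
        using y by (auto simp: C_def intro: add_nonneg_pos add_pos_nonneg)
      have "1 + t\<^sup>2 \<le> C * ((t - x)\<^sup>2 + y\<^sup>2)"
        unfolding C_def by (rule Poisson_kernel_comparison[OF y])
      then have "1 / ((t - x)\<^sup>2 + y\<^sup>2) \<le> C / (1 + t\<^sup>2)"
        using pos by (simp add: field_simps)
      then have "\<bar>u t\<bar> * (1 / ((t - x)\<^sup>2 + y\<^sup>2)) \<le> \<bar>u t\<bar> * (C / (1 + t\<^sup>2))"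
        by (rule mult_left_mono) simp
      then show ?thesis
        using pos by (simp add: abs_mult abs_of_pos mult.commute)
    qed
    then show "AE t in lborel. norm (u t / ((t - x)\<^sup>2 + y\<^sup>2)) \<le> norm (C * (u t / (1 + t\<^sup>2)))"
      by simp
  qed simp
qed

lemma integrable_Poisson_cmod:
  fixes u :: "real \<Rightarrow> real"
  assumes "integrable lborel (\<lambda>t. u t / (1 + t\<^sup>2))" "Im z \<noteq> 0"
  shows "integrable lborel (\<lambda>t. u t / (cmod (of_real t - z))\<^sup>2)"
  using integrable_Poisson[OF assms, of "Re z"] by (simp add: cmod_power2)

subsection \<open>The Cauchy transform\<close>

text \<open>The real kernel \<open>t / (1 + t\<^sup>2)\<close> makes the integral converge. It does not contribute to the
  real part of the transform, and for even \<open>u\<close> oddness makes the imaginary part vanish on the imaginary axis.\<close>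

definition Cauchy_transform :: "(real \<Rightarrow> real) \<Rightarrow> complex \<Rightarrow> complex" where
  "Cauchy_transform u z =
     (LINT t|lborel. of_real (u t) * (1 / (of_real t - z) - of_real (t / (1 + t\<^sup>2)))) / (of_real pi * \<i>)"

lemma abs_Im_le_cmod_of_real_diff: "\<bar>Im z\<bar> \<le> cmod (of_real t - z)"
  using abs_Im_le_cmod[of "of_real t - z"] by simp

text \<open>The two kernels cancel to order \<open>1 / (1 + t^2)\<close>: their difference is
  \<open>((1 + z^2) / (t - z) + z) / (1 + t^2)\<close>, and the numerator is bounded since
  \<open>|t - z| \<ge> |Im z|\<close>.\<close>

lemma integrable_Cauchy_transform:
  assumes u: "integrable lborel (\<lambda>t. u t / (1 + t\<^sup>2))" and z: "Im z \<noteq> 0"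
  shows "integrable lborel
    (\<lambda>t. of_real (u t) * (1 / (of_real t - z) - of_real (t / (1 + t\<^sup>2))) :: complex)"
proof -
  define C where "C = cmod (1 + z\<^sup>2) / \<bar>Im z\<bar> + cmod z"
  have [measurable]: "u \<in> borel_measurable borel"
    by (rule borel_measurable_of_Cauchy_integrable[OF u])
  have "integrable lborel (\<lambda>t. C * (u t / (1 + t\<^sup>2)))"
    using u by (rule integrable_mult_right)
  then show ?thesis
  proof (rule Bochner_Integration.integrable_bound)
    have "cmod (of_real (u t) * (1 / (of_real t - z) - of_real (t / (1 + t\<^sup>2))))
        \<le> norm (C * (u t / (1 + t\<^sup>2)))" for t
    proof -
      have y: "0 < \<bar>Im z\<bar>" "\<bar>Im z\<bar> \<le> cmod (of_real t - z)"
        using z abs_Im_le_cmod_of_real_diff by auto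
      then have nz: "of_real t - z \<noteq> 0"
        by auto
      have pos: "0 < 1 + t\<^sup>2"
        by (simp add: add_pos_nonneg)
      then have nz': "1 + (of_real t)\<^sup>2 \<noteq> (0::complex)"
        by (metis of_real_1 of_real_add of_real_eq_0_iff of_real_power less_irrefl)
      have "1 / (of_real t - z) - of_real (t / (1 + t\<^sup>2))
          = ((1 + z\<^sup>2) / (of_real t - z) + z) / of_real (1 + t\<^sup>2)"
        using nz nz' by (simp add: field_simps power2_eq_square)
      also have "cmod \<dots> \<le> C / (1 + t\<^sup>2)"
      proof -
        have "cmod ((1 + z\<^sup>2) / (of_real t - z) + z) \<le> cmod ((1 + z\<^sup>2) / (of_real t - z)) + cmod z"
          by (rule norm_triangle_ineq)
        also have "cmod ((1 + z\<^sup>2) / (of_real t - z)) \<le> cmod (1 + z\<^sup>2) / \<bar>Im z\<bar>"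
          unfolding norm_divide using y by (intro divide_left_mono mult_pos_pos) auto
        finally have "cmod ((1 + z\<^sup>2) / (of_real t - z) + z) \<le> C"
          by (simp add: C_def)
        then show ?thesis
          using pos unfolding norm_divide norm_of_real by (simp add: divide_right_mono)
      qed
      finally have "\<bar>u t\<bar> * cmod (1 / (of_real t - z) - of_real (t / (1 + t\<^sup>2))) \<le> \<bar>u t\<bar> * (C / (1 + t\<^sup>2))"
        by (intro mult_left_mono) auto
      moreover have "0 \<le> C"
        by (simp add: C_def)
      ultimately show ?thesis
        using pos by (simp add: norm_mult abs_mult mult.commute)
    qed
    then show "AE t in lborel. cmod (of_real (u t) * (1 / (of_real t - z) - of_real (t / (1 + t\<^sup>2))))
        \<le> norm (C * (u t / (1 + t\<^sup>2)))"
      by simp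
  qed measurable
qed

text \<open>Division by \<open>pi * \<i>\<close> turns the imaginary part of the integral into the
  real part, and \<open>Im (1 / (t - z)) = Im z / |t - z|^2\<close> is \<open>pi\<close> times the
  Poisson kernel.\<close>

lemma Re_Cauchy_transform:
  assumes u: "integrable lborel (\<lambda>t. u t / (1 + t\<^sup>2))" and z: "Im z \<noteq> 0"
  shows "Re (Cauchy_transform u z) = Im z / pi * (LINT t|lborel. u t / ((t - Re z)\<^sup>2 + (Im z)\<^sup>2))"
proof -
  let ?I = "LINT t|lborel. of_real (u t) * (1 / (of_real t - z) - of_real (t / (1 + t\<^sup>2)))"
  have "Im ?I = (LINT t|lborel. Im (of_real (u t) * (1 / (of_real t - z) - of_real (t / (1 + t\<^sup>2)))))"
    using integral_Im[OF integrable_Cauchy_transform[OF u z]] by simp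
  also have "\<dots> = (LINT t|lborel. Im z * (u t / ((t - Re z)\<^sup>2 + (Im z)\<^sup>2)))"
    by (intro Bochner_Integration.integral_cong refl) (simp add: Im_divide)
  also have "\<dots> = Im z * (LINT t|lborel. u t / ((t - Re z)\<^sup>2 + (Im z)\<^sup>2))"
    by (rule integral_mult_right_zero)
  finally show ?thesis
    by (simp add: Cauchy_transform_def Re_divide power2_eq_square)
qed

lemma Im_Cauchy_transform_imaginary_axis:
  assumes u: "integrable lborel (\<lambda>t. u t / (1 + t\<^sup>2))" and even: "\<And>t. u (-t) = u t" and y: "y \<noteq> 0"
  shows "Im (Cauchy_transform u (\<i> * of_real y)) = 0"
proof -
  let ?f = "\<lambda>t. u t * (t / (t\<^sup>2 + y\<^sup>2) - t / (1 + t\<^sup>2))"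
  let ?I = "LINT t|lborel. of_real (u t) * (1 / (of_real t - \<i> * of_real y) - of_real (t / (1 + t\<^sup>2)))"
  have "Re ?I = (LINT t|lborel. Re (of_real (u t) * (1 / (of_real t - \<i> * of_real y) - of_real (t / (1 + t\<^sup>2)))))"
    using integral_Re[OF integrable_Cauchy_transform[OF u, of "\<i> * of_real y"]] y by simp
  also have "\<dots> = (LINT t|lborel. ?f t)"
    by (intro Bochner_Integration.integral_cong refl) (simp add: Re_divide del: of_real_divide)
  also have "\<dots> = 0"
  proof -
    have "(LINT t|lborel. ?f t) = (LINT t|lborel. ?f (- t))"
      using lborel_integral_real_affine[of "-1" ?f 0] by simp
    also have "\<dots> = (LINT t|lborel. - ?f t)"
      by (intro Bochner_Integration.integral_cong refl) (simp add: even algebra_simps)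
    also have "\<dots> = - (LINT t|lborel. ?f t)"
      by simp
    finally show ?thesis by simp
  qed
  finally show ?thesis
    by (simp add: Cauchy_transform_def Im_divide)
qed

text \<open>Allows differentiation under the integral sign by one explicit remainder
  estimate.\<close>

lemma DERIV_if_quadratic_remainder:
  fixes f :: "'a::real_normed_field \<Rightarrow> 'a"
  assumes "e > 0" and "\<And>w. norm (w - z) < e \<Longrightarrow> norm (f w - f z - (w - z) * D) \<le> C * (norm (w - z))\<^sup>2"
  shows "(f has_field_derivative D) (at z)"
proof -
  have "((\<lambda>w. (f w - f z) / (w - z) - D) \<longlongrightarrow> 0) (at z)"
  proof (rule Lim_null_comparison)
    show "\<forall>\<^sub>F w in at z. norm ((f w - f z) / (w - z) - D) \<le> C * norm (w - z)"
      unfolding eventually_at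
    proof (intro exI conjI ballI impI)
      fix w assume w: "w \<noteq> z \<and> dist w z < e"
      then have "(f w - f z) / (w - z) - D = (f w - f z - (w - z) * D) / (w - z)"
        by (simp add: field_simps)
      then have "norm ((f w - f z) / (w - z) - D) = norm (f w - f z - (w - z) * D) / norm (w - z)"
        by (simp add: norm_divide)
      also have "\<dots> \<le> C * (norm (w - z))\<^sup>2 / norm (w - z)"
        using w assms(2)[of w] by (intro divide_right_mono) (auto simp: dist_norm)
      finally show "norm ((f w - f z) / (w - z) - D) \<le> C * norm (w - z)"
        using w by (simp add: power2_eq_square)
    qed (fact assms(1))
    have "((\<lambda>w. C * norm (w - z)) \<longlongrightarrow> C * norm (z - z)) (at z)"
      by (intro tendsto_intros)
    then show "((\<lambda>w. C * norm (w - z)) \<longlongrightarrow> 0) (at z)"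
      by simp
  qed
  then show ?thesis
    by (simp add: has_field_derivative_iff LIM_zero_iff)
qed

text \<open>The first-order Taylor remainder of \<open>1 / (t - z)\<close> is exactly
  \<open>(w - z)^2 / ((t - w) * (t - z)^2)\<close>, so integrating it gives a quadratic bound once
  \<open>|t - w|\<close> is bounded below uniformly in \<open>t\<close>.\<close>

lemma holomorphic_Cauchy_transform:
  assumes u: "integrable lborel (\<lambda>t. u t / (1 + t\<^sup>2))"
  shows "Cauchy_transform u holomorphic_on {z. Im z > 0}"
proof -
  let ?k = "\<lambda>t z. of_real (u t) * (1 / (of_real t - z) - of_real (t / (1 + t\<^sup>2))) :: complex"
  have [measurable]: "u \<in> borel_measurable borel"
    by (rule borel_measurable_of_Cauchy_integrable[OF u])
  have "\<exists>D. (Cauchy_transform u has_field_derivative D) (at z)" if z: "Im z > 0" for z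
  proof -
    define v where "v t = u t / (cmod (of_real t - z))\<^sup>2" for t
    have v: "integrable lborel v"
      unfolding v_def using integrable_Poisson_cmod[OF u] z by simp
    let ?d = "\<lambda>t. of_real (u t) / (of_real t - z)\<^sup>2 :: complex"
    have d: "integrable lborel ?d"
      by (rule Bochner_Integration.integrable_bound[OF v])
         (auto simp: v_def norm_divide norm_power)
    define c where "c = complex_of_real pi * \<i>"
    have "(Cauchy_transform u has_field_derivative (LINT t|lborel. ?d t) / c) (at z)"
    proof (rule DERIV_if_quadratic_remainder[where e = "Im z / 2"
          and C = "2 / Im z * (LINT t|lborel. \<bar>v t\<bar>) / cmod c"])
      fix w assume w: "cmod (w - z) < Im z / 2"
      have "\<bar>Im w - Im z\<bar> \<le> cmod (w - z)"
        using abs_Im_le_cmod[of "w - z"] by simp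
      \<comment> \<open>The radius \<open>Im z / 2\<close> keeps \<open>w\<close> away from the real
        axis; this gives \<open>|t - w| \<ge> Im z / 2\<close> and the factor
        \<open>2 / Im z\<close>.\<close>
      then have Imw: "Im w > Im z / 2"
        using w by linarith
      have int: "integrable lborel (\<lambda>t. ?k t w)" "integrable lborel (\<lambda>t. ?k t z)"
        using integrable_Cauchy_transform[OF u] z Imw by auto
      have d': "integrable lborel (\<lambda>t. (w - z) * ?d t)"
        by (intro integrable_mult_right d)
      have "Cauchy_transform u w - Cauchy_transform u z - (w - z) * ((LINT t|lborel. ?d t) / c)
          = ((LINT t|lborel. ?k t w) - (LINT t|lborel. ?k t z) - (w - z) * (LINT t|lborel. ?d t)) / c"
        by (simp add: Cauchy_transform_def c_def diff_divide_distrib)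
      also have "\<dots> = (LINT t|lborel. ?k t w - ?k t z - (w - z) * ?d t) / c"
        by (simp only: Bochner_Integration.integral_diff[OF Bochner_Integration.integrable_diff[OF int] d']
            Bochner_Integration.integral_diff[OF int] integral_mult_right_zero)
      finally have "cmod (Cauchy_transform u w - Cauchy_transform u z - (w - z) * ((LINT t|lborel. ?d t) / c))
          = cmod (LINT t|lborel. ?k t w - ?k t z - (w - z) * ?d t) / cmod c"
        by (simp only: norm_divide)
      also have "\<dots> \<le> (LINT t|lborel. 2 / Im z * (cmod (w - z))\<^sup>2 * \<bar>v t\<bar>) / cmod c"
      proof (rule divide_right_mono[OF Bochner_Integration.integral_norm_bound_integral norm_ge_zero])
        show "integrable lborel (\<lambda>t. ?k t w - ?k t z - (w - z) * ?d t)"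
          by (intro Bochner_Integration.integrable_diff int d')
        show "integrable lborel (\<lambda>t. 2 / Im z * (cmod (w - z))\<^sup>2 * \<bar>v t\<bar>)"
          using v by simp
        fix t
        have nz: "of_real t - w \<noteq> 0" "of_real t - z \<noteq> 0"
          using abs_Im_le_cmod_of_real_diff[of w t] abs_Im_le_cmod_of_real_diff[of z t] z Imw by auto
        have "?k t w - ?k t z - (w - z) * ?d t
            = of_real (u t) * (1 / (of_real t - w) - 1 / (of_real t - z) - (w - z) / (of_real t - z)\<^sup>2)"
          by (simp add: algebra_simps)
        also have "1 / (of_real t - w) - 1 / (of_real t - z) - (w - z) / (of_real t - z)\<^sup>2
            = (w - z)\<^sup>2 / ((of_real t - w) * (of_real t - z)\<^sup>2)"
          using nz by (simp add: divide_simps) (simp add: power2_eq_square algebra_simps)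
        finally have "cmod (?k t w - ?k t z - (w - z) * ?d t)
            = (1 / cmod (of_real t - w)) * ((cmod (w - z))\<^sup>2 * \<bar>v t\<bar>)"
          by (simp add: v_def norm_mult norm_divide norm_power)
        also have "\<dots> \<le> 1 / (Im z / 2) * ((cmod (w - z))\<^sup>2 * \<bar>v t\<bar>)"
          using abs_Im_le_cmod_of_real_diff[of w t] z Imw by (intro mult_right_mono frac_le) auto
        also have "\<dots> = 2 / Im z * (cmod (w - z))\<^sup>2 * \<bar>v t\<bar>"
          by simp
        finally show "cmod (?k t w - ?k t z - (w - z) * ?d t) \<le> 2 / Im z * (cmod (w - z))\<^sup>2 * \<bar>v t\<bar>" .
      qed
      also have "\<dots> = 2 / Im z * (LINT t|lborel. \<bar>v t\<bar>) / cmod c * (cmod (w - z))\<^sup>2"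
        unfolding integral_mult_right_zero by (simp add: mult_ac)
      finally show "cmod (Cauchy_transform u w - Cauchy_transform u z - (w - z) * ((LINT t|lborel. ?d t) / c))
          \<le> 2 / Im z * (LINT t|lborel. \<bar>v t\<bar>) / cmod c * (cmod (w - z))\<^sup>2" .
    qed (use z in simp)
    then show ?thesis ..
  qed
  then show ?thesis
    by (subst holomorphic_on_open) (auto simp: open_halfspace_Im_gt)
qed

text \<open>The Cauchy transform is holomorphic with real part the harmonic extension, and its
  imaginary part already has the required normalization because the boundary function is
  even.\<close>

lemma normalized_conjugate_exists:
  assumes "integrable lborel (\<lambda>t. w \<bar>t\<bar> / (1 + t\<^sup>2))"
  shows "normalized_conjugate (harmonic_extension w) (\<lambda>z. Im (Cauchy_transform (\<lambda>t. w \<bar>t\<bar>) z))"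
proof -
  let ?F = "Cauchy_transform (\<lambda>t. w \<bar>t\<bar>)"
  have "harmonic_extension w z = Re (?F z)" if "Im z > 0" for z
    using Re_Cauchy_transform[OF assms, of z] that by (simp add: harmonic_extension_def)
  then have "(\<lambda>z. of_real (harmonic_extension w z) + \<i> * of_real (Im (?F z))) holomorphic_on {z. Im z > 0}"
    by (intro holomorphic_transform[OF holomorphic_Cauchy_transform[OF assms]])
       (simp add: complex_eq)
  moreover have "Im (?F (\<i> * of_real y)) = 0" if "y > 0" for y
    using that by (intro Im_Cauchy_transform_imaginary_axis assms) auto
  ultimately show ?thesis
    by (simp add: normalized_conjugate_def harmonic_conjugate_on_def)
qed

subsection \<open>Poisson integrals of logarithms and powers\<close>

lemma ln_le_two_sqrt:
  fixes x :: real
  assumes "x > 0"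
  shows "ln x \<le> 2 * x powr (1/2)"
proof -
  have "ln x = 2 * ln (x powr (1/2))"
    using assms by (simp add: ln_powr)
  also have "\<dots> \<le> 2 * x powr (1/2)"
    using ln_bound[of "x powr (1/2)"] assms by simp
  finally show ?thesis .
qed

text \<open>Up to a constant this is the statement that \<open>ln \<bar>z\<bar>\<close> is the Poisson integral of
  its own boundary values.\<close>

lemma harmonic_extension_ge_ln:
  "\<exists>C. \<forall>w a b z. integrable lborel (\<lambda>t. w \<bar>t\<bar> / (1 + t\<^sup>2)) \<longrightarrow> 0 \<le> a \<longrightarrow>
    (\<forall>t>0. a * ln t + b \<le> w t) \<longrightarrow> Im z > 0 \<longrightarrow>
    a * (ln (cmod z) - C) + b \<le> harmonic_extension w z"
proof (intro exI allI impI)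
  \<comment> \<open>The factor 8 is 2 from \<open>ln x \<le> 2 * x powr (1/2)\<close> times 4 from
    the kernel bound \<open>4 / r\<close>.\<close>
  define g :: "real \<Rightarrow> real" where "g s = 8 * (indicator {-1..1} s * \<bar>s\<bar> powr (-1/2))" for s
  have g: "integrable lborel g"
    unfolding g_def by (intro integrable_mult_right integrable_inverse_sqrt_abs)
  define J where "J = (LINT s|lborel. g s)"
  fix w :: "real \<Rightarrow> real" and a b :: real and z :: complex
  assume w: "integrable lborel (\<lambda>t. w \<bar>t\<bar> / (1 + t\<^sup>2))" and a: "0 \<le> a"
    and le: "\<forall>t>0. a * ln t + b \<le> w t" and z: "Im z > 0"
  define r where "r = cmod z"
  have r: "0 < r" "Im z \<le> r"
    using z abs_Im_le_cmod[of z] by (auto simp: r_def)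
  define k where "k t = Im z / ((t - Re z)\<^sup>2 + (Im z)\<^sup>2)" for t
  have k: "has_bochner_integral lborel k pi"
    unfolding k_def using z by (rule has_bochner_integral_Poisson_kernel)
  have k_nonneg: "0 \<le> k t" for t
    using z by (simp add: k_def)
  \<comment> \<open>Such \<open>t\<close> has distance at least \<open>r / 2\<close> from
    \<open>z\<close>, while \<open>Im z \<le> r\<close>; the bound survives when \<open>z\<close>
    approaches the real axis.\<close>
  have k_near_0: "k t \<le> 4 / r" if "\<bar>t\<bar> \<le> r / 2" for t
  proof -
    have "(t - Re z)\<^sup>2 + (Im z)\<^sup>2 = (cmod (z - of_real t))\<^sup>2"
      by (simp add: cmod_power2 power2_commute)
    moreover have "r / 2 \<le> cmod (z - of_real t)"
      using norm_triangle_ineq2[of z "of_real t"] that by (simp add: r_def)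
    then have "(r / 2)\<^sup>2 \<le> (cmod (z - of_real t))\<^sup>2"
      using r by (intro power_mono) auto
    ultimately have "k t \<le> r / (r / 2)\<^sup>2"
      unfolding k_def using r z by (intro frac_le) auto
    also have "\<dots> = 4 / r"
      using r by (simp add: power2_eq_square)
    finally show ?thesis .
  qed
  \<comment> \<open>Scale invariance: the integral does not depend on \<open>r\<close>, hence the
    final constant does not depend on \<open>z\<close>.\<close>
  have gr: "has_bochner_integral lborel (\<lambda>t. g (t / r) / r) J"
  proof -
    have "has_bochner_integral lborel (\<lambda>s. g (s / r)) (r * J)"
      using r has_bochner_integral_integrable[OF g]
      by (subst lborel_has_bochner_integral_real_affine_iff[where c = r and t = 0])
        (simp_all add: J_def flip: mult.assoc)
    from has_bochner_integral_divide_zero[of r, OF this] show ?thesis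
      using r by simp
  qed
  \<comment> \<open>Only for \<open>|t| < r / 2\<close> does \<open>ln |t|\<close> fall below
    \<open>ln (r / 2)\<close>, and there the rescaled \<open>g\<close> absorbs the deficit. The
    minorant of \<open>w\<close> is given for positive arguments, so the null set \<open>{0}\<close>
    is left out.\<close>
  have pointwise: "(a * (ln r - ln 2) + b) * k t - a * (g (t / r) / r) \<le> w \<bar>t\<bar> * k t" if t: "t \<noteq> 0" for t
  proof -
    have "(ln r - ln 2 - ln \<bar>t\<bar>) * k t \<le> g (t / r) / r"
    proof (cases "\<bar>t\<bar> \<le> r / 2")
      case True
      have "ln r - ln 2 - ln \<bar>t\<bar> \<le> ln (r / \<bar>t\<bar>)"
        using r t by (simp add: ln_div)
      also have "\<dots> \<le> 2 * (r / \<bar>t\<bar>) powr (1/2)"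
        using r t by (intro ln_le_two_sqrt) simp
      also have "(r / \<bar>t\<bar>) powr (1/2) = \<bar>t / r\<bar> powr (-1/2)"
        using r t by (simp add: powr_minus_divide powr_divide)
      finally have "(ln r - ln 2 - ln \<bar>t\<bar>) * k t \<le> 2 * \<bar>t / r\<bar> powr (-1/2) * k t"
        using k_nonneg by (intro mult_right_mono)
      also have "\<dots> \<le> 2 * \<bar>t / r\<bar> powr (-1/2) * (4 / r)"
        using k_near_0[OF True] by (intro mult_left_mono) auto
      also have "\<dots> = g (t / r) / r"
      proof -
        have "\<bar>t / r\<bar> \<le> 1"
          using True r by (simp add: divide_simps)
        then show ?thesis
          unfolding abs_le_iff by (simp add: g_def indicator_def)
      qed
      finally show ?thesis .
    next
      case False
      then have "ln (r / 2) \<le> ln \<bar>t\<bar>"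
        using r by (subst ln_le_cancel_iff) auto
      then have "ln r - ln 2 - ln \<bar>t\<bar> \<le> 0"
        using r by (simp add: ln_div)
      then have "(ln r - ln 2 - ln \<bar>t\<bar>) * k t \<le> 0"
        using k_nonneg by (intro mult_nonpos_nonneg)
      also have "0 \<le> g (t / r) / r"
        using r by (simp add: g_def)
      finally show ?thesis .
    qed
    then have "a * ((ln r - ln 2 - ln \<bar>t\<bar>) * k t) \<le> a * (g (t / r) / r)"
      using a by (rule mult_left_mono)
    moreover have "(a * ln \<bar>t\<bar> + b) * k t \<le> w \<bar>t\<bar> * k t"
      using le t k_nonneg by (intro mult_right_mono) auto
    ultimately show ?thesis
      by (simp add: algebra_simps)
  qed
  have lhs: "has_bochner_integral lborel (\<lambda>t. (a * (ln r - ln 2) + b) * k t - a * (g (t / r) / r))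
      ((a * (ln r - ln 2) + b) * pi - a * J)"
    by (intro has_bochner_integral_diff has_bochner_integral_mult_right k gr)
  have "integrable lborel (\<lambda>t. Im z * (w \<bar>t\<bar> / ((t - Re z)\<^sup>2 + (Im z)\<^sup>2)))"
    using z by (intro integrable_mult_right integrable_Poisson[OF w]) auto
  then have rhs: "integrable lborel (\<lambda>t. w \<bar>t\<bar> * k t)"
    by (simp add: k_def mult.commute)
  have "(a * (ln r - ln 2) + b) * pi - a * J
      = (LINT t|lborel. (a * (ln r - ln 2) + b) * k t - a * (g (t / r) / r))"
    using lhs by (simp add: has_bochner_integral_iff)
  also have "\<dots> \<le> (LINT t|lborel. w \<bar>t\<bar> * k t)"
  proof (rule integral_mono_AE)
    show "integrable lborel (\<lambda>t. (a * (ln r - ln 2) + b) * k t - a * (g (t / r) / r))"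
      using lhs by (simp add: has_bochner_integral_iff)
    show "AE t in lborel. (a * (ln r - ln 2) + b) * k t - a * (g (t / r) / r) \<le> w \<bar>t\<bar> * k t"
      using AE_lborel_singleton[of "0::real"] by eventually_elim (rule pointwise)
  qed (fact rhs)
  also have "(LINT t|lborel. w \<bar>t\<bar> * k t)
      = (LINT t|lborel. Im z * (w \<bar>t\<bar> / ((t - Re z)\<^sup>2 + (Im z)\<^sup>2)))"
    by (intro Bochner_Integration.integral_cong refl) (simp add: k_def)
  also have "\<dots> = Im z * (LINT t|lborel. w \<bar>t\<bar> / ((t - Re z)\<^sup>2 + (Im z)\<^sup>2))"
    by (rule integral_mult_right_zero)
  also have "\<dots> = pi * harmonic_extension w z"
    using z by (simp add: harmonic_extension_def)
  finally have "pi * (a * (ln r - (ln 2 + J / pi)) + b) \<le> pi * harmonic_extension w z"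
    by (simp add: algebra_simps)
  then show "a * (ln (cmod z) - (ln 2 + J / pi)) + b \<le> harmonic_extension w z"
    by (simp add: r_def)
qed

text \<open>After the substitution \<open>t = y * s\<close> the power contributes its mean against
  the Cauchy density, which is finite as \<open>d < 1\<close> and the same for all
  \<open>y\<close>.\<close>

lemma harmonic_extension_le_powr:
  assumes d: "0 < d" "d < (1::real)"
  shows "\<exists>C. \<forall>w A B y. integrable lborel (\<lambda>t. w \<bar>t\<bar> / (1 + t\<^sup>2)) \<longrightarrow> 0 < y \<longrightarrow>
    (\<forall>t\<ge>0. w t \<le> A + B * (t / y) powr d) \<longrightarrow>
    harmonic_extension w (\<i> * of_real y) \<le> A + B * C"
proof (intro exI allI impI)
  define J where "J = (LINT s|lborel. \<bar>s\<bar> powr d / (1 + s\<^sup>2))"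
  fix w :: "real \<Rightarrow> real" and A B y :: real
  assume w: "integrable lborel (\<lambda>t. w \<bar>t\<bar> / (1 + t\<^sup>2))" and y: "0 < y"
    and le: "\<forall>t\<ge>0. w t \<le> A + B * (t / y) powr d"
  define k where "k t = y / (t\<^sup>2 + y\<^sup>2)" for t
  have k: "has_bochner_integral lborel k pi"
    unfolding k_def using has_bochner_integral_Poisson_kernel[OF y, of 0] by simp
  have k_nonneg: "0 \<le> k t" for t
    using y by (simp add: k_def)
  have kd: "has_bochner_integral lborel (\<lambda>t. \<bar>t / y\<bar> powr d * k t) J"
  proof -
    have "\<bar>(0 + y * s) / y\<bar> powr d * k (0 + y * s) = \<bar>s\<bar> powr d / (1 + s\<^sup>2) / y" for s
    proof -
      have "(y * s)\<^sup>2 + y\<^sup>2 = y * (y * (1 + s\<^sup>2))"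
        by (simp add: power2_eq_square algebra_simps)
      then show ?thesis
        using y by (simp add: k_def)
    qed
    moreover have "has_bochner_integral lborel (\<lambda>s. \<bar>s\<bar> powr d / (1 + s\<^sup>2) / y) (J / y)"
      using has_bochner_integral_divide_zero[of y, OF has_bochner_integral_integrable[OF
            integrable_powr_Cauchy_density[OF d]]]
      unfolding J_def by simp
    ultimately show ?thesis
      using y by (subst lborel_has_bochner_integral_real_affine_iff[where c = y and t = 0])
        (auto simp: divide_inverse mult.commute)
  qed
  have rhs: "has_bochner_integral lborel (\<lambda>t. A * k t + B * (\<bar>t / y\<bar> powr d * k t)) (A * pi + B * J)"
    by (intro has_bochner_integral_add has_bochner_integral_mult_right k kd)
  have "pi * harmonic_extension w (\<i> * of_real y) = y * (LINT t|lborel. w \<bar>t\<bar> / (t\<^sup>2 + y\<^sup>2))"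
    using y by (simp add: harmonic_extension_def)
  also have "\<dots> = (LINT t|lborel. y * (w \<bar>t\<bar> / (t\<^sup>2 + y\<^sup>2)))"
    by (rule integral_mult_right_zero[symmetric])
  also have "\<dots> \<le> (LINT t|lborel. A * k t + B * (\<bar>t / y\<bar> powr d * k t))"
  proof (rule integral_mono)
    show "integrable lborel (\<lambda>t. y * (w \<bar>t\<bar> / (t\<^sup>2 + y\<^sup>2)))"
      using integrable_Poisson[OF w, of y 0] y by (intro integrable_mult_right) auto
    show "integrable lborel (\<lambda>t. A * k t + B * (\<bar>t / y\<bar> powr d * k t))"
      using rhs by (simp add: has_bochner_integral_iff)
    fix t :: real
    have "w \<bar>t\<bar> * k t \<le> (A + B * \<bar>t / y\<bar> powr d) * k t"
      using le y k_nonneg by (intro mult_right_mono) auto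
    then show "y * (w \<bar>t\<bar> / (t\<^sup>2 + y\<^sup>2)) \<le> A * k t + B * (\<bar>t / y\<bar> powr d * k t)"
      by (simp add: k_def algebra_simps add_divide_distrib)
  qed
  also have "\<dots> = pi * (A + B * (J / pi))"
    using rhs by (simp add: has_bochner_integral_iff algebra_simps)
  finally show "harmonic_extension w (\<i> * of_real y) \<le> A + B * (J / pi)"
    by simp
qed

subsection \<open>Weight sequences\<close>

lemma weight_sequence_pos: "weight_sequence M \<Longrightarrow> M p > 0"
  by (simp add: weight_sequence_def)

lemma quotient_seq_pos: "weight_sequence M \<Longrightarrow> quotient_seq M p > 0"
  by (simp add: quotient_seq_def weight_sequence_pos)

text \<open>This is logarithmic convexity rewritten; the instance used is at \<open>Suc p\<close>,
  since convexity is indexed from 1.\<close>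

lemma quotient_seq_mono:
  assumes M: "weight_sequence M"
  shows "mono (quotient_seq M)"
proof (rule monoI, rule lift_Suc_mono_le)
  fix p
  have "(M (Suc p))\<^sup>2 \<le> M (Suc p - 1) * M (Suc p + 1)"
    using M unfolding weight_sequence_def by (metis One_nat_def Suc_le_mono zero_le)
  then show "quotient_seq M p \<le> quotient_seq M (Suc p)"
    using weight_sequence_pos[OF M, of p] weight_sequence_pos[OF M, of "Suc p"]
    by (simp add: quotient_seq_def field_simps power2_eq_square)
qed

lemma ln_power_div:
  assumes "weight_sequence M" "t > 0"
  shows "ln (t ^ p / M p) = real p * ln t - ln (M p)"
  using assms weight_sequence_pos[OF assms(1), of p] by (simp add: ln_div ln_realpow)

text \<open>The supremum defining \<open>omega M t\<close> is attained at \<open>p = #{j. m\<^sub>j \<le> t}\<close>.\<close>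

lemma omega_attained:
  assumes M: "weight_sequence M" and t: "t > 0"
  obtains p where "\<And>j. j < p \<Longrightarrow> quotient_seq M j \<le> t" "t < quotient_seq M p"
    "\<And>q. real q * ln t - ln (M q) \<le> real p * ln t - ln (M p)"
    "omega M t = real p * ln t - ln (M p)"
proof -
  define m where "m = quotient_seq M"
  define p where "p = (LEAST j. t < m j)"
  have "eventually (\<lambda>j. t < m j) sequentially"
    using M by (auto simp: weight_sequence_def m_def filterlim_at_top_dense)
  then have "\<exists>j. t < m j"
    using eventually_happens'[OF sequentially_bot] by blast
  then have p: "t < m p"
    unfolding p_def by (rule LeastI_ex)
  have below: "m j \<le> t" if "j < p" for j
    using not_less_Least[of j "\<lambda>j. t < m j"] that by (simp add: p_def)
  define c where "c q = real q * ln t - ln (M q)" for q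
  \<comment> \<open>As \<open>m\<close> is monotone, these increments are nonnegative before
    \<open>p\<close> and nonpositive from \<open>p\<close> on, so \<open>c\<close> peaks at
    \<open>p\<close>.\<close>
  have c_Suc: "c (Suc q) = c q + (ln t - ln (m q))" for q
    using weight_sequence_pos[OF M, of q] weight_sequence_pos[OF M, of "Suc q"]
    by (simp add: c_def m_def quotient_seq_def ln_div algebra_simps)
  have c_le: "c q \<le> c p" for q
  proof (cases "q \<le> p")
    case True
    then show ?thesis
    proof (induction rule: inc_induct)
      case (step n)
      have "ln (m n) \<le> ln t"
        using below[of n] step quotient_seq_pos[OF M, of n] t by (simp add: m_def)
      then show ?case
        using step c_Suc[of n] by simp
    qed simp
  next
    case False
    then have "p \<le> q" by simp
    then show ?thesis
    proof (induction rule: dec_induct)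
      case (step n)
      have "t \<le> m n"
        using p monoD[OF quotient_seq_mono[OF M], of p n] step by (simp add: m_def)
      then have "ln t \<le> ln (m n)"
        using t by simp
      then show ?case
        using step c_Suc[of n] by simp
    qed simp
  qed
  have "omega M t = (SUP q. c q)"
    using t by (simp add: omega_def c_def ln_power_div[OF M])
  also have "\<dots> = c p"
    by (rule cSup_eq_maximum) (auto intro: c_le)
  finally show thesis
    using that[of p] p below c_le by (simp add: c_def m_def)
qed

lemma omega_ge:
  assumes M: "weight_sequence M" and t: "t > 0"
  shows "real q * ln t - ln (M q) \<le> omega M t"
  using omega_attained[OF assms] by metis

lemma omega_nonneg:
  assumes M: "weight_sequence M"
  shows "0 \<le> omega M t"
  using omega_ge[OF M, of t 0] M by (cases "t > 0") (auto simp: omega_def weight_sequence_def)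

text \<open>The maximizing index at \<open>s\<close> is a competitor at \<open>t\<close>.
  Monotonicity also provides Borel measurability.\<close>

lemma omega_mono:
  assumes M: "weight_sequence M"
  shows "mono (omega M)"
proof (rule monoI)
  fix s t :: real assume st: "s \<le> t"
  show "omega M s \<le> omega M t"
  proof (cases "s > 0")
    case True
    obtain p where "omega M s = real p * ln s - ln (M p)"
      using omega_attained[OF M True] by metis
    also have "\<dots> \<le> real p * ln t - ln (M p)"
      using True st by (simp add: mult_left_mono)
    also have "\<dots> \<le> omega M t"
      using True st by (intro omega_ge[OF M]) simp
    finally show ?thesis .
  next
    case False
    then show ?thesis
      using omega_nonneg[OF M] by (simp add: omega_def)
  qed
qed

section \<open>Growth of \<open>omega M\<close> when the index exceeds 1\<close>

lemma gamma_index_gt_oneD: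
  assumes "gamma_index M > 1"
  obtains g where "g > 1" "almost_increasing (\<lambda>p. quotient_seq M p / real (p + 1) powr g)"
proof -
  obtain g where "1 < ennreal g" "almost_increasing (\<lambda>p. quotient_seq M p / real (p + 1) powr g)"
    using assms by (auto simp: gamma_index_def less_Sup_iff)
  moreover from this(1) have "g > 1"
    by (metis ennreal_1 ennreal_less_iff zero_le_one)
  ultimately show thesis
    using that by blast
qed

text \<open>For \<open>q > p\<close>, almost monotonicity between \<open>p\<close> and
  \<open>q - 1\<close> gives \<open>y / (p + 1)^g \<le> a * y * s / q^g\<close>; taking
  \<open>g\<close>-th roots yields the bound. For \<open>q \<le> p\<close> it follows from
  \<open>a * s \<ge> 1\<close>.\<close>

lemma maximizing_index_growth:
  fixes g a s :: real
  assumes M: "weight_sequence M" and g: "g > 0" and a: "a \<ge> 1"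
    and inc: "\<And>p q. p \<le> q \<Longrightarrow>
      quotient_seq M p / real (p + 1) powr g \<le> a * (quotient_seq M q / real (q + 1) powr g)"
    and y: "y > 0" and s: "s \<ge> 1"
    and p: "y < quotient_seq M p" and q: "\<And>j. j < q \<Longrightarrow> quotient_seq M j \<le> y * s"
  shows "real q \<le> real (p + 1) * (a * s) powr (1 / g)"
proof (cases "q \<le> p")
  case True
  have "1 \<le> (a * s) powr (1 / g)"
    using a s g by (intro ge_one_powr_ge_zero) (auto intro: mult_ge1_I)
  then have "real (p + 1) * 1 \<le> real (p + 1) * (a * s) powr (1 / g)"
    by (intro mult_left_mono) auto
  moreover have "real q \<le> real (p + 1) * 1"
    using True by simp
  ultimately show ?thesis
    by (rule order_trans[rotated])
next
  case False
  then obtain j where j: "q = Suc j" "p \<le> j"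
    by (cases q) auto
  have "y / real (p + 1) powr g \<le> quotient_seq M p / real (p + 1) powr g"
    using p by (intro divide_right_mono) auto
  also have "\<dots> \<le> a * (quotient_seq M j / real (j + 1) powr g)"
    by (rule inc[OF j(2)])
  also have "\<dots> \<le> a * (y * s / real (j + 1) powr g)"
    using q[of j] j a by (intro mult_left_mono divide_right_mono) auto
  finally have "y * real q powr g \<le> y * (a * s * real (p + 1) powr g)"
    using j by (simp add: field_simps)
  then have "real q powr g \<le> a * s * real (p + 1) powr g"
    using y by simp
  then have "(real q powr g) powr (1 / g) \<le> (a * s * real (p + 1) powr g) powr (1 / g)"
    using g by (intro powr_mono2) auto
  also have "\<dots> = (a * s) powr (1 / g) * (real (p + 1) powr g) powr (1 / g)"
    using a s by (simp add: powr_mult)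
  finally show ?thesis
    using g by (simp add: powr_powr mult.commute)
qed

text \<open>The error is proportional to \<open>p + 1\<close>, where \<open>p\<close> is the maximizing index at \<open>y\<close>;
  a bound by a multiple of \<open>omega M y\<close> would not do, since without moderate growth
  it cannot be absorbed by a dilation of the argument.\<close>

lemma omega_growth:
  assumes M: "weight_sequence M" and "gamma_index M > 1"
  obtains d B where "0 < d" "d < 1"
    "\<And>y. 0 < y \<Longrightarrow> \<exists>p. \<forall>t\<ge>0.
       omega M t \<le> real p * ln y - ln (M p) + real (p + 1) * B * (t / y) powr d"
proof -
  obtain g where g: "g > 1" "almost_increasing (\<lambda>p. quotient_seq M p / real (p + 1) powr g)"
    using gamma_index_gt_oneD[OF assms(2)] .
  then obtain a0 where a0: "a0 > 0" "\<And>p q. p \<le> q \<Longrightarrow>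
      quotient_seq M p / real (p + 1) powr g \<le> a0 * (quotient_seq M q / real (q + 1) powr g)"
    unfolding almost_increasing_def by blast
  \<comment> \<open>Enlarging the constant to at least 1 meets the condition of
    \<open>maximizing_index_growth\<close>.\<close>
  define a where "a = max 1 a0"
  have inc: "quotient_seq M p / real (p + 1) powr g \<le> a * (quotient_seq M q / real (q + 1) powr g)"
    if "p \<le> q" for p q
  proof -
    have "a0 * (quotient_seq M q / real (q + 1) powr g) \<le> a * (quotient_seq M q / real (q + 1) powr g)"
      using quotient_seq_pos[OF M, of q] by (intro mult_right_mono) (auto simp: a_def)
    with a0(2)[OF that] show ?thesis by linarith
  qed
  have a: "a \<ge> 1" by (simp add: a_def)
  \<comment> \<open>Half the gap between \<open>1 / g\<close> and 1: the power
    \<open>s powr e\<close> pays for the factor \<open>ln s\<close>, and the total exponent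
    \<open>1 / g + e\<close> stays below 1.\<close>
  define e where "e = (1 - 1 / g) / 2"
  have e: "0 < e" "1 / g + e < 1"
    using g by (auto simp: e_def field_simps)
  define B where "B = a powr (1 / g) / e"
  have "0 \<le> B"
    using e by (simp add: B_def)
  show thesis
  proof (rule that[of "1 / g + e" B])
    show "0 < 1 / g + e" "1 / g + e < 1"
      using e g by (auto intro: add_pos_pos)
    fix y :: real assume y: "0 < y"
    obtain p where p: "y < quotient_seq M p" "omega M y = real p * ln y - ln (M p)"
      using omega_attained[OF M y] by metis
    have "omega M t \<le> omega M y + real (p + 1) * B * (t / y) powr (1 / g + e)" if t: "0 \<le> t" for t
    proof (cases "t \<le> y")
      case True
      then have "omega M t \<le> omega M y"
        by (rule monoD[OF omega_mono[OF M]])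
      then show ?thesis
        using \<open>0 \<le> B\<close> by (simp add: add_increasing2)
    next
      case False
      define s where "s = t / y"
      have s: "s \<ge> 1" "t = y * s"
        using y False by (auto simp: s_def)
      have "t > 0" using y False by linarith
      obtain q where q: "\<And>j. j < q \<Longrightarrow> quotient_seq M j \<le> t" "omega M t = real q * ln t - ln (M q)"
        using omega_attained[OF M \<open>t > 0\<close>] by metis
      have "real q \<le> real (p + 1) * (a * s) powr (1 / g)"
        using maximizing_index_growth[OF M _ a inc y s(1) p(1), of q] q(1) g s(2) by auto
      moreover have "ln s \<le> s powr e / e"
        using s(1) e(1) by (intro ln_powr_bound)
      ultimately have "real q * ln s \<le> (real (p + 1) * (a * s) powr (1 / g)) * (s powr e / e)"
        using s by (intro mult_mono) auto
      also have "\<dots> = real (p + 1) * B * s powr (1 / g + e)"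
        using s a by (simp add: B_def powr_mult powr_add)
      finally have *: "real q * ln s \<le> real (p + 1) * B * s powr (1 / g + e)" .
      \<comment> \<open>Splitting \<open>ln t = ln y + ln s\<close> in the maximal term at
        \<open>t\<close> leaves a competitor for the supremum at \<open>y\<close>.\<close>
      have "omega M t = (real q * ln y - ln (M q)) + real q * ln s"
        using q(2) s y by (simp add: ln_mult algebra_simps)
      also have "real q * ln y - ln (M q) \<le> omega M y"
        by (rule omega_ge[OF M y])
      finally show ?thesis
        using * by (simp add: s_def)
    qed
    then show "\<exists>p. \<forall>t\<ge>0. omega M t
        \<le> real p * ln y - ln (M p) + real (p + 1) * B * (t / y) powr (1 / g + e)"
      unfolding p(2) by blast
  qed
qed

text \<open>The growth estimate at \<open>y = 1\<close> bounds \<open>omega M\<close> by a constant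
  plus a multiple of \<open>t powr d\<close> with \<open>d < 1\<close>.\<close>

lemma integrable_omega:
  assumes M: "weight_sequence M" and "gamma_index M > 1"
  shows "integrable lborel (\<lambda>t. omega M \<bar>t\<bar> / (1 + t\<^sup>2))"
proof -
  obtain d B where d: "0 < d" "d < 1"
    and gr: "\<And>y. 0 < y \<Longrightarrow> \<exists>p. \<forall>t\<ge>0.
       omega M t \<le> real p * ln y - ln (M p) + real (p + 1) * B * (t / y) powr d"
    using omega_growth[OF assms] by metis
  obtain p where p: "\<And>t. 0 \<le> t \<Longrightarrow> omega M t \<le> - ln (M p) + real (p + 1) * B * t powr d"
    using gr[of 1] by auto
  define A where "A = \<bar>ln (M p)\<bar>"
  define B' where "B' = real (p + 1) * B"
  have [measurable]: "omega M \<in> borel_measurable borel"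
    using omega_mono[OF M] by (rule borel_measurable_mono)
  have "integrable lborel (\<lambda>t::real. A * (1 / (1 + t\<^sup>2)) + B' * (\<bar>t\<bar> powr d / (1 + t\<^sup>2)))"
    by (intro Bochner_Integration.integrable_add integrable_mult_right
        integrable_Cauchy_density integrable_powr_Cauchy_density d)
  then show ?thesis
  proof (rule Bochner_Integration.integrable_bound)
    have "norm (omega M \<bar>t\<bar> / (1 + t\<^sup>2)) \<le> norm (A * (1 / (1 + t\<^sup>2)) + B' * (\<bar>t\<bar> powr d / (1 + t\<^sup>2)))"
      for t :: real
    proof -
      have "omega M \<bar>t\<bar> \<le> A + B' * \<bar>t\<bar> powr d"
        using p[of "\<bar>t\<bar>"] by (simp add: A_def B'_def)
      then have "omega M \<bar>t\<bar> / (1 + t\<^sup>2) \<le> (A + B' * \<bar>t\<bar> powr d) / (1 + t\<^sup>2)"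
        by (rule divide_right_mono) simp
      also have "\<dots> = A * (1 / (1 + t\<^sup>2)) + B' * (\<bar>t\<bar> powr d / (1 + t\<^sup>2))"
        by (simp add: add_divide_distrib)
      finally show ?thesis
        using omega_nonneg[OF M, of "\<bar>t\<bar>"] by simp
    qed
    then show "AE t in lborel. norm (omega M \<bar>t\<bar> / (1 + t\<^sup>2))
        \<le> norm (A * (1 / (1 + t\<^sup>2)) + B' * (\<bar>t\<bar> powr d / (1 + t\<^sup>2)))"
      by simp
  qed simp
qed

section \<open>Optimal flatness in the right half-plane\<close>

lemma unbounded_sector_right_half_plane: "unbounded_sector {z. Re z > 0}"
  unfolding unbounded_sector_def
  using Arg_Re_pos by (intro exI[of _ 1]) auto

text \<open>Shifting the logarithm by \<open>C\<close> dilates the argument of the monomial by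
  \<open>exp C\<close>. The upper estimate uses this with \<open>C\<close>, the lower one with
  \<open>- D\<close>.\<close>

lemma exp_ln_monomial:
  assumes "weight_sequence M" "r > 0"
  shows "exp (- (real p * (ln (1 / r) - C) - ln (M p))) = M p * (exp C * r) ^ p"
proof -
  have "exp (- (real p * (ln (1 / r) - C) - ln (M p))) = exp (ln (M p)) * exp (real p * (C + ln r))"
    using assms by (simp add: ln_div flip: exp_add) (simp add: algebra_simps)
  also have "\<dots> = M p * (exp C * r) ^ p"
    using assms weight_sequence_pos[OF assms(1), of p] by (simp add: exp_of_nat_mult exp_add)
  finally show ?thesis .
qed

text \<open>Existence of \<open>Q\<close> is part of the conclusion, so that the quantification over
  all normalized conjugates is not vacuous.\<close>

theorem proposition3p9:
  fixes M :: "nat \<Rightarrow> real"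
  assumes "weight_sequence M"
    and "gamma_index M > 1"
  shows "(\<exists>Q. normalized_conjugate (harmonic_extension (omega M)) Q) \<and>
    (\<forall>Q. normalized_conjugate (harmonic_extension (omega M)) Q \<longrightarrow>
       optimal_flat M {z. Re z > 0}
         (\<lambda>z. exp (- complex_of_real (harmonic_extension (omega M) (\<i> / z))
                   - \<i> * complex_of_real (Q (\<i> / z)))))"
proof (intro conjI allI impI)
  note M = assms(1) and int = integrable_omega[OF assms]
  let ?P = "harmonic_extension (omega M)"
  show "\<exists>Q. normalized_conjugate ?P Q"
    using normalized_conjugate_exists[OF int] by blast
  fix Q assume Q: "normalized_conjugate ?P Q"
  let ?F = "\<lambda>z. complex_of_real (?P z) + \<i> * complex_of_real (Q z)"
  let ?G = "\<lambda>z. exp (- complex_of_real (?P (\<i> / z)) - \<i> * complex_of_real (Q (\<i> / z)))"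
  have Im_pos: "Im (\<i> / z) > 0" if "Re z > 0" for z
    using that by (simp add: Im_divide add_pos_nonneg)
  have cmod_G: "cmod (?G z) = exp (- ?P (\<i> / z))" for z
    by simp
  have "?F holomorphic_on {z. Im z > 0}"
    using Q by (simp add: normalized_conjugate_def harmonic_conjugate_on_def)
  moreover have "(\<lambda>z. \<i> / z) holomorphic_on {z. Re z > 0}"
    by (intro holomorphic_intros) auto
  ultimately have "?F \<circ> (\<lambda>z. \<i> / z) holomorphic_on {z. Re z > 0}"
    using Im_pos by (intro holomorphic_on_compose_gen[where t = "{z. Im z > 0}"]) auto
  then have "(\<lambda>z. exp (- ((?F \<circ> (\<lambda>z. \<i> / z)) z))) holomorphic_on {z. Re z > 0}"
    by (intro holomorphic_intros)
  then have hol: "?G holomorphic_on {z. Re z > 0}"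
    by (simp only: o_apply minus_add_distrib add_uminus_conv_diff)
  obtain C where C: "\<forall>w a b z. integrable lborel (\<lambda>t. w \<bar>t\<bar> / (1 + t\<^sup>2)) \<longrightarrow> 0 \<le> a \<longrightarrow>
      (\<forall>t>0. a * ln t + b \<le> w t) \<longrightarrow> Im z > 0 \<longrightarrow>
      a * (ln (cmod z) - C) + b \<le> harmonic_extension w z"
    using harmonic_extension_ge_ln ..
  \<comment> \<open>The constant \<open>C\<close> is chosen before the slope \<open>p\<close>, so
    every monomial is dilated by the same \<open>exp C\<close> and the infimum over \<open>p\<close>
    can be taken.\<close>
  have upper: "cmod (?G z) \<le> h_fun M (exp C * cmod z)" if z: "Re z > 0" for z
    unfolding h_fun_def
  proof (rule cINF_greatest)
    fix p
    have "real p * (ln (cmod (\<i> / z)) - C) + (- ln (M p)) \<le> ?P (\<i> / z)"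
      using omega_ge[OF M, of _ p] Im_pos[OF z]
      by (intro C[rule_format, where w = "omega M"] int) auto
    then have "exp (- ?P (\<i> / z)) \<le> exp (- (real p * (ln (1 / cmod z) - C) - ln (M p)))"
      by (simp add: norm_divide)
    also have "\<dots> = M p * (exp C * cmod z) ^ p"
      using z by (intro exp_ln_monomial M) auto
    finally show "cmod (?G z) \<le> M p * (exp C * cmod z) ^ p"
      unfolding cmod_G .
  qed simp
  obtain d B where d: "0 < d" "d < 1"
    and gr: "\<And>y. 0 < y \<Longrightarrow> \<exists>p. \<forall>t\<ge>0.
       omega M t \<le> real p * ln y - ln (M p) + real (p + 1) * B * (t / y) powr d"
    using omega_growth[OF assms] by metis
  obtain J where J: "\<forall>w A B y. integrable lborel (\<lambda>t. w \<bar>t\<bar> / (1 + t\<^sup>2)) \<longrightarrow> 0 < y \<longrightarrow>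
      (\<forall>t\<ge>0. w t \<le> A + B * (t / y) powr d) \<longrightarrow>
      harmonic_extension w (\<i> * of_real y) \<le> A + B * J"
    using harmonic_extension_le_powr[OF d] ..
  define D where "D = B * J"
  have lower: "?G (of_real x) \<in> \<real> \<and> exp (- D) * h_fun M (exp (- D) * x) \<le> Re (?G (of_real x))"
    if x: "x > 0" for x :: real
  proof -
    have ix: "\<i> / of_real x = \<i> * of_real (1 / x)"
      by simp
    have "\<forall>y>0. Q (\<i> * of_real y) = 0"
      using Q by (simp add: normalized_conjugate_def)
    \<comment> \<open>The map \<open>z \<mapsto> \<i> / z\<close> sends the positive reals to the
      positive imaginary axis, where the normalization makes \<open>?G\<close> real.\<close>
    then have Q0: "Q (\<i> / of_real x) = 0"
      unfolding ix using x by (metis zero_less_divide_1_iff)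
    have G: "?G (of_real x) = of_real (exp (- ?P (\<i> / of_real x)))"
      by (simp add: Q0 flip: exp_of_real)
    obtain p where p: "\<forall>t\<ge>0.
        omega M t \<le> real p * ln (1 / x) - ln (M p) + real (p + 1) * B * (t / (1 / x)) powr d"
      using gr[of "1 / x"] x by auto
    have "?P (\<i> / of_real x) \<le> real p * ln (1 / x) - ln (M p) + real (p + 1) * B * J"
      unfolding ix by (intro J[rule_format, where w = "omega M"] int p[rule_format]) (use x in simp_all)
    \<comment> \<open>The error \<open>(p + 1) * D\<close> is split: one \<open>D\<close> becomes
      the factor \<open>exp (- D)\<close>, the remaining \<open>p * D\<close> becomes a dilation of
      the \<open>p\<close>-th monomial. The sign of \<open>D\<close> is irrelevant as
      \<open>exp (- D) > 0\<close>.\<close>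
    also have "\<dots> = D + (real p * (ln (1 / x) - (- D)) - ln (M p))"
      by (simp add: D_def algebra_simps)
    finally have "exp (- D) * exp (- (real p * (ln (1 / x) - (- D)) - ln (M p))) \<le> exp (- ?P (\<i> / of_real x))"
      by (simp flip: exp_add)
    moreover have "h_fun M (exp (- D) * x) \<le> M p * (exp (- D) * x) ^ p"
      unfolding h_fun_def
    proof (rule cINF_lower)
      show "bdd_below (range (\<lambda>p. M p * (exp (- D) * x) ^ p))"
        using x weight_sequence_pos[OF M] by (intro bdd_belowI2[of _ 0]) (simp add: less_imp_le)
    qed simp
    ultimately have "exp (- D) * h_fun M (exp (- D) * x) \<le> exp (- ?P (\<i> / of_real x))"
      unfolding exp_ln_monomial[OF M x] by (meson exp_ge_zero mult_left_mono order_trans)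
    then show ?thesis
      unfolding G by simp
  qed
  show "optimal_flat M {z. Re z > 0} ?G"
    unfolding optimal_flat_def
  proof (intro conjI unbounded_sector_right_half_plane hol, rule exI[of _ "exp (- D)"],
      rule exI[of _ "exp (- D)"], rule exI[of _ 1], rule exI[of _ "exp C"],
      intro conjI allI impI ballI)
    show "exp (- D) > 0" "exp (- D) > 0" "(1::real) > 0" "exp C > 0"
      by simp_all
    show "?G (of_real x) \<in> \<real>" "exp (- D) * h_fun M (exp (- D) * x) \<le> Re (?G (of_real x))"
      if "x > 0" for x :: real
      using lower[OF that] by blast+
    show "cmod (?G z) \<le> 1 * h_fun M (exp C * cmod z)" if "z \<in> {z. Re z > 0}" for z
      using upper[of z] that by simp
  qed
qed

end
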